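(* Let $A(\delta)$ be an $m\times n$ matrix and $b(\delta)$ an $m$-vector whose entries are polynomials of degree at most $D$ in $\delta\in\mathbb{R}$. If there exists $\epsilon>0$ such that for every $\delta\in(0,\epsilon)$ there exists $x_1(\delta)\in\mathbb{R}^n$ with $A(\delta)x_1(\delta)\ge b(\delta)$, then there exists a vector of rational functions $x(\delta)$ and $\epsilon'>0$ such that $A(\delta)x(\delta)\ge b(\delta)$ for all $\delta\in(0,\epsilon')$. Further, one can take $x(\delta)=A_J^+(\delta)b_J(\delta)$ for some subset $J\subseteq[m]$ of constraints, and the numerators and the least common multiple of the denominators of all entries of $x(\delta)$ have degree at most $2nD$.
   Context: For $J\subseteq[m]$, $A_J$ is the $|J|\times n$ matrix of rows of $A$ indexed by $J$, $b_J$ the corresponding subvector, and $M^+$ denotes the Moore–Penrose pseudoinverse of a matrix $M$. *)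

theory Defs
  imports
    "Jordan_Normal_Form.DL_Submatrix"
    "HOL-Computational_Algebra.Computational_Algebra"
    "HOL-Computational_Algebra.Field_as_Ring"
begin

definition eval_mat :: "real poly mat \<Rightarrow> real \<Rightarrow> real mat" where
  "eval_mat A \<delta> = map_mat (\<lambda>p. poly p \<delta>) A"

definition eval_vec :: "real poly vec \<Rightarrow> real \<Rightarrow> real vec" where
  "eval_vec b \<delta> = map_vec (\<lambda>p. poly p \<delta>) b"

definition row_submatrix :: "'a mat \<Rightarrow> nat set \<Rightarrow> 'a mat" where
  "row_submatrix A J = submatrix A J UNIV"

text \<open>The entries are listed in increasing order of their indices, as in \<^const>\<open>submatrix\<close>.\<close>

definition subvec :: "'a vec \<Rightarrow> nat set \<Rightarrow> 'a vec" where
  "subvec b J = vec (card {i. i < dim_vec b \<and> i \<in> J}) (\<lambda>i. b $ pick J i)"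

text \<open>The four Penrose equations; over the reals the adjoint is the transpose.\<close>

definition is_pseudoinverse :: "real mat \<Rightarrow> real mat \<Rightarrow> bool" where
  "is_pseudoinverse M X \<longleftrightarrow>
     X \<in> carrier_mat (dim_col M) (dim_row M) \<and>
     M * X * M = M \<and>
     X * M * X = X \<and>
     transpose_mat (M * X) = M * X \<and>
     transpose_mat (X * M) = X * M"

definition pseudoinverse :: "real mat \<Rightarrow> real mat" where
  "pseudoinverse M = (THE X. is_pseudoinverse M X)"

lemma is_pseudoinverse_unique:
  assumes "is_pseudoinverse M X" and "is_pseudoinverse M Y"
  shows "X = Y"
proof -
  obtain r c where M: "M \<in> carrier_mat r c" by blast
  have X: "X \<in> carrier_mat c r" and Y: "Y \<in> carrier_mat c r"
    using assms M unfolding is_pseudoinverse_def by auto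
  note cX = assms(1)[unfolded is_pseudoinverse_def]
  note cY = assms(2)[unfolded is_pseudoinverse_def]
  have MX: "M * X \<in> carrier_mat r r" and MY: "M * Y \<in> carrier_mat r r"
    and XM: "X * M \<in> carrier_mat c c" and YM: "Y * M \<in> carrier_mat c c"
    using M X Y by auto
  have X1: "M * X * M = M" and X2: "X * M * X = X"
    and X3: "transpose_mat (M * X) = M * X" and X4: "transpose_mat (X * M) = X * M"
    using cX by blast+
  have Y1: "M * Y * M = M" and Y2: "Y * M * Y = Y"
    and Y3: "transpose_mat (M * Y) = M * Y" and Y4: "transpose_mat (Y * M) = Y * M"
    using cY by blast+
  have a: "M * Y * (M * X) = M * X"
    using assoc_mult_mat[OF MY M X] Y1 by simp
  have b: "M * X * (M * Y) = M * Y"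
    using assoc_mult_mat[OF MX M Y] X1 by simp
  have c: "X * M * (Y * M) = X * M"
    using assoc_mult_mat[OF X M YM] assoc_mult_mat[OF M Y M] Y1 by simp
  have d: "Y * M * (X * M) = Y * M"
    using assoc_mult_mat[OF Y M XM] assoc_mult_mat[OF M X M] X1 by simp
  have 1: "M * X = M * Y"
    using transpose_mult[OF MY MX] unfolding a b X3 Y3 .
  have 2: "X * M = Y * M"
    using transpose_mult[OF XM YM] unfolding c d X4 Y4 .
  have "X = Y * M * X" using X2 unfolding 2 by simp
  also have "\<dots> = Y * (M * X)" using assoc_mult_mat[OF Y M X] .
  also have "\<dots> = Y * M * Y" unfolding 1 using assoc_mult_mat[OF Y M Y] by simp
  finally show ?thesis unfolding Y2 .
qed

lemma pseudoinverse_eqI: "is_pseudoinverse M X \<Longrightarrow> pseudoinverse M = X"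
  unfolding pseudoinverse_def using is_pseudoinverse_unique by blast

text \<open>Numerator and denominator of a rational function in lowest terms, with monic denominator.\<close>

definition rat_num :: "real poly fract \<Rightarrow> real poly" where
  "rat_num r = fst (quot_of_fract r)"

definition rat_den :: "real poly fract \<Rightarrow> real poly" where
  "rat_den r = snd (quot_of_fract r)"

text \<open>At a pole this returns the junk value 0 of division by zero, so poles have to be
  excluded explicitly where the function is used.\<close>

definition rat_eval :: "real poly fract \<Rightarrow> real \<Rightarrow> real" where
  "rat_eval r \<delta> = poly (rat_num r) \<delta> / poly (rat_den r) \<delta>"

definition rat_eval_vec :: "real poly fract vec \<Rightarrow> real \<Rightarrow> real vec" where
  "rat_eval_vec x \<delta> = map_vec (\<lambda>r. rat_eval r \<delta>) x"

end

theory Submission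
  imports Defs "Jordan_Normal_Form.Char_Poly"
begin

text \<open>For a fixed \<open>\<delta>\<close>, the constraints tight at a feasible point with as many tight constraints as
  possible form a set \<open>J\<close> such that \<open>A\<^sub>J y = b\<^sub>J\<close> is solvable and all its solutions are feasible.
  Shrinking \<open>J\<close> as far as this property permits makes the rows of \<open>A\<^sub>J\<close> independent. Hence \<open>|J| \<le> n\<close>, the Gram matrix
  \<open>A\<^sub>J A\<^sub>J\<^sup>T\<close> is invertible, and \<open>A\<^sub>J\<^sup>+ b\<^sub>J = A\<^sub>J\<^sup>T (A\<^sub>J A\<^sub>J\<^sup>T)\<^sup>-\<^sup>1 b\<^sub>J\<close> is feasible. By Cramer's rule this
  is a quotient of polynomials in \<open>\<delta>\<close> with denominator \<open>det (A\<^sub>J A\<^sub>J\<^sup>T)\<close>, whose degrees are bounded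
  because the entries of \<open>A\<^sub>J A\<^sub>J\<^sup>T\<close> have degree at most \<open>2D\<close>. As there are finitely many \<open>J\<close>, one of
  them works for arbitrarily small \<open>\<delta> > 0\<close>; since it is determined by signs of polynomials whether
  \<open>J\<close> works, and these signs do not change near \<open>0\<close>, it works for all small \<open>\<delta> > 0\<close>.\<close>

no_notation fps_nth (infixl "$" 75)

section \<open>Row submatrices\<close>

lemma card_restrict_subset: "J \<subseteq> {..<m} \<Longrightarrow> card {i. i < m \<and> i \<in> J} = card J"
  by (rule arg_cong[of _ _ card]) auto

lemma pick_less: "J \<subseteq> {..<m} \<Longrightarrow> i < card J \<Longrightarrow> pick J i < m"
  using pick_in_set_le by blast

lemma image_pick:
  assumes "finite J"
  shows "pick J ` {..<card J} = J"
proof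
  show "pick J ` {..<card J} \<subseteq> J" using pick_in_set_le by blast
  have "i \<in> pick J ` {..<card J}" if "i \<in> J" for i
  proof (rule image_eqI)
    show "i = pick J (card {a \<in> J. a < i})" using pick_card_in_set[OF that] by simp
    show "card {a \<in> J. a < i} \<in> {..<card J}"
      using assms that by (auto intro!: psubset_card_mono)
  qed
  then show "J \<subseteq> pick J ` {..<card J}" by blast
qed

lemma inj_on_pick: "finite J \<Longrightarrow> inj_on (pick J) {..<card J}"
  by (rule eq_card_imp_inj_on) (simp_all add: image_pick)

lemma row_submatrix_carrier:
  "A \<in> carrier_mat m n \<Longrightarrow> J \<subseteq> {..<m} \<Longrightarrow> row_submatrix A J \<in> carrier_mat (card J) n"
  by (auto simp: row_submatrix_def dim_submatrix card_restrict_subset)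

lemma row_submatrix_index:
  assumes "A \<in> carrier_mat m n" "J \<subseteq> {..<m}" "i < card J" "j < n"
  shows "row_submatrix A J $$ (i, j) = A $$ (pick J i, j)"
  using assms unfolding row_submatrix_def
  by (subst submatrix_index) (auto simp: card_restrict_subset pick_UNIV)

lemma row_row_submatrix:
  assumes "A \<in> carrier_mat m n" "J \<subseteq> {..<m}" "i < card J"
  shows "row (row_submatrix A J) i = row A (pick J i)"
  using assms row_submatrix_carrier[OF assms(1,2)] pick_less[OF assms(2,3)]
  by (intro eq_vecI) (auto simp: row_submatrix_index)

lemma subvec_carrier: "b \<in> carrier_vec m \<Longrightarrow> J \<subseteq> {..<m} \<Longrightarrow> subvec b J \<in> carrier_vec (card J)"
  by (auto simp: subvec_def card_restrict_subset)

lemma subvec_index: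
  "b \<in> carrier_vec m \<Longrightarrow> J \<subseteq> {..<m} \<Longrightarrow> i < card J \<Longrightarrow> subvec b J $ i = b $ pick J i"
  by (auto simp: subvec_def card_restrict_subset)

lemma row_submatrix_map_mat:
  assumes A: "A \<in> carrier_mat m n" and J: "J \<subseteq> {..<m}"
  shows "row_submatrix (map_mat f A) J = map_mat f (row_submatrix A J)"
proof -
  have fA: "map_mat f A \<in> carrier_mat m n" using A by simp
  note dims = row_submatrix_carrier[OF A J] row_submatrix_carrier[OF fA J]
  show ?thesis
  proof (rule eq_matI)
    fix i j
    assume "i < dim_row (map_mat f (row_submatrix A J))"
      "j < dim_col (map_mat f (row_submatrix A J))"
    then have "i < card J" "j < n" using dims by auto
    then show "row_submatrix (map_mat f A) J $$ (i, j) = map_mat f (row_submatrix A J) $$ (i, j)"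
      using A dims pick_less[OF J]
      by (simp add: row_submatrix_index[OF A J] row_submatrix_index[OF fA J])
  qed (use dims in auto)
qed

lemma subvec_map_vec:
  assumes "b \<in> carrier_vec m" "J \<subseteq> {..<m}"
  shows "subvec (map_vec f b) J = map_vec f (subvec b J)"
  using assms pick_less[OF assms(2)]
  by (intro eq_vecI) (auto simp: subvec_def card_restrict_subset)

section \<open>Systems of linear inequalities\<close>

definition polyhedron :: "'a :: {semiring_0, ord} mat \<Rightarrow> 'a vec \<Rightarrow> 'a vec set" where
  "polyhedron A b = {x \<in> carrier_vec (dim_col A). b \<le> A *\<^sub>v x}"

definition equality_set :: "'a :: semiring_0 mat \<Rightarrow> 'a vec \<Rightarrow> nat set \<Rightarrow> 'a vec set" where
  "equality_set A b J = {x \<in> carrier_vec (dim_col A). row_submatrix A J *\<^sub>v x = subvec b J}"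

definition tight_rows :: "'a :: semiring_0 mat \<Rightarrow> 'a vec \<Rightarrow> 'a vec \<Rightarrow> nat set" where
  "tight_rows A b x = {i. i < dim_row A \<and> row A i \<bullet> x = b $ i}"

lemma mem_polyhedron_iff:
  assumes "A \<in> carrier_mat m n" "b \<in> carrier_vec m"
  shows "x \<in> polyhedron A b \<longleftrightarrow> x \<in> carrier_vec n \<and> (\<forall>i<m. b $ i \<le> row A i \<bullet> x)"
  using assms by (auto simp: polyhedron_def less_eq_vec_def)

lemma mem_equality_set_iff:
  assumes A: "A \<in> carrier_mat m n" and b: "b \<in> carrier_vec m" and J: "J \<subseteq> {..<m}"
  shows "x \<in> equality_set A b J \<longleftrightarrow> x \<in> carrier_vec n \<and> (\<forall>j\<in>J. row A j \<bullet> x = b $ j)"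
proof -
  have "finite J" using J finite_subset by blast
  have "row_submatrix A J *\<^sub>v x = subvec b J \<longleftrightarrow> (\<forall>i<card J. row A (pick J i) \<bullet> x = b $ pick J i)"
    using row_submatrix_carrier[OF A J] subvec_carrier[OF b J]
    by (simp add: vec_eq_iff row_row_submatrix[OF A J] subvec_index[OF b J])
  also have "\<dots> \<longleftrightarrow> (\<forall>j\<in>pick J ` {..<card J}. row A j \<bullet> x = b $ j)" by blast
  finally show ?thesis
    using A by (simp add: equality_set_def image_pick[OF \<open>finite J\<close>])
qed

text \<open>The ratio test: moving from \<open>f\<close> to \<open>g\<close>, stop at the first constraint that becomes tight.\<close>

lemma convex_combination_first_tight:
  fixes b f g :: "'i \<Rightarrow> 'a :: linordered_field"
  assumes fin: "finite I" and f: "\<And>i. i \<in> I \<Longrightarrow> b i \<le> f i" and violated: "\<exists>i\<in>I. g i < b i"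
  obtains t k where "0 \<le> t" "t \<le> 1" "k \<in> I" "g k < b k" "(1 - t) * f k + t * g k = b k"
    "\<forall>i\<in>I. b i \<le> (1 - t) * f i + t * g i"
proof -
  define K where "K = {i \<in> I. g i < b i}"
  define r where "r i = (f i - b i) / (f i - g i)" for i
  have "finite K" "K \<noteq> {}" using fin violated by (auto simp: K_def)
  then obtain k where k: "k \<in> K" and least: "\<And>i. i \<in> K \<Longrightarrow> r k \<le> r i"
    using arg_min_if_finite(1)[of K r] arg_min_least[of K _ r] by metis
  have descent: "b i \<le> f i" "0 < f i - g i" if "i \<in> K" for i
    using that f[of i] by (auto simp: K_def)
  have r01: "0 \<le> r k" "r k \<le> 1" using descent[OF k] k by (auto simp: r_def K_def)
  have "b i \<le> (1 - r k) * f i + r k * g i" if i: "i \<in> I" for i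
  proof (cases "i \<in> K")
    case True
    have "r k * (f i - g i) \<le> f i - b i"
      using least[OF True] descent(2)[OF True] by (simp only: r_def[of i] pos_le_divide_eq)
    then show ?thesis by (simp add: algebra_simps)
  next
    case False
    then have "(1 - r k) * b i + r k * b i \<le> (1 - r k) * f i + r k * g i"
      using i f r01 by (intro add_mono mult_left_mono) (auto simp: K_def)
    then show ?thesis by (simp add: algebra_simps)
  qed
  moreover have "r k * (f k - g k) = f k - b k" using descent[OF k] by (simp add: r_def)
  then have "(1 - r k) * f k + r k * g k = b k" by (simp add: algebra_simps)
  ultimately show thesis using k r01 by (intro that) (auto simp: K_def)
qed

lemma ex_more_tight_rows:
  fixes A :: "'a :: linordered_field mat"
  assumes A: "A \<in> carrier_mat m n" and b: "b \<in> carrier_vec m"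
    and x: "x \<in> polyhedron A b" and y: "y \<in> equality_set A b (tight_rows A b x)"
    and y_infeasible: "y \<notin> polyhedron A b"
  shows "\<exists>z\<in>polyhedron A b. tight_rows A b x \<subset> tight_rows A b z"
proof -
  let ?T = "tight_rows A b"
  have Tm: "?T x \<subseteq> {..<m}" using A by (auto simp: tight_rows_def)
  have xn: "x \<in> carrier_vec n" and xf: "\<And>i. i \<in> {..<m} \<Longrightarrow> b $ i \<le> row A i \<bullet> x"
    using x by (auto simp: mem_polyhedron_iff[OF A b])
  have yn: "y \<in> carrier_vec n" and yT: "\<And>j. j \<in> ?T x \<Longrightarrow> row A j \<bullet> y = b $ j"
    using y by (auto simp: mem_equality_set_iff[OF A b Tm])
  have violated: "\<exists>i\<in>{..<m}. row A i \<bullet> y < b $ i"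
    using y_infeasible yn by (auto simp: mem_polyhedron_iff[OF A b] not_le)
  obtain t k where "0 \<le> t" "t \<le> 1" and k: "k \<in> {..<m}" "row A k \<bullet> y < b $ k"
    and zk: "(1 - t) * (row A k \<bullet> x) + t * (row A k \<bullet> y) = b $ k"
    and zf: "\<forall>i\<in>{..<m}. b $ i \<le> (1 - t) * (row A i \<bullet> x) + t * (row A i \<bullet> y)"
    by (rule convex_combination_first_tight[OF finite_lessThan xf violated])
  define z where "z = (1 - t) \<cdot>\<^sub>v x + t \<cdot>\<^sub>v y"
  have zn: "z \<in> carrier_vec n" using xn yn by (simp add: z_def)
  have row_z: "row A i \<bullet> z = (1 - t) * (row A i \<bullet> x) + t * (row A i \<bullet> y)" if "i < m" for i
  proof -
    have "row A i \<in> carrier_vec n" using A by auto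
    then show ?thesis using xn yn by (simp add: z_def scalar_prod_add_distrib[of _ n])
  qed
  have "z \<in> polyhedron A b" using zn zf by (simp add: mem_polyhedron_iff[OF A b] row_z)
  moreover have "row A j \<bullet> z = b $ j" if "j \<in> ?T x" for j
  proof -
    have "row A j \<bullet> x = b $ j" using that by (simp add: tight_rows_def)
    with that Tm show ?thesis by (auto simp: row_z yT algebra_simps)
  qed
  then have "?T x \<subseteq> ?T z" by (auto simp: tight_rows_def)
  moreover have "k \<in> ?T z" using A k zk row_z by (simp add: tight_rows_def)
  moreover have "k \<notin> ?T x" using k yT by force
  ultimately show ?thesis by blast
qed

lemma ex_equality_set_subset_polyhedron:
  fixes A :: "'a :: linordered_field mat"
  assumes A: "A \<in> carrier_mat m n" and b: "b \<in> carrier_vec m" and ne: "polyhedron A b \<noteq> {}"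
  shows "\<exists>J\<subseteq>{..<m}. equality_set A b J \<noteq> {} \<and> equality_set A b J \<subseteq> polyhedron A b"
proof -
  let ?T = "tight_rows A b"
  have Tm: "?T x \<subseteq> {..<m}" for x using A by (auto simp: tight_rows_def)
  then have "?T ` polyhedron A b \<subseteq> Pow {..<m}" by blast
  then have "finite (?T ` polyhedron A b)" by (rule finite_subset) simp
  then obtain x where x: "x \<in> polyhedron A b"
    and maximal: "\<And>z. z \<in> polyhedron A b \<Longrightarrow> \<not> ?T x \<subset> ?T z"
    using ne finite_has_maximal[of "?T ` polyhedron A b"] by blast
  have "x \<in> equality_set A b (?T x)"
    using x unfolding mem_equality_set_iff[OF A b Tm] mem_polyhedron_iff[OF A b]
    by (simp add: tight_rows_def)
  moreover have "equality_set A b (?T x) \<subseteq> polyhedron A b"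
    using ex_more_tight_rows[OF A b x] maximal by blast
  ultimately show ?thesis using Tm by blast
qed

section \<open>Independent rows\<close>

definition independent_rows :: "'a :: semiring_0 mat \<Rightarrow> bool" where
  "independent_rows M \<longleftrightarrow>
     (\<forall>v\<in>carrier_vec (dim_row M). transpose_mat M *\<^sub>v v = 0\<^sub>v (dim_col M) \<longrightarrow> v = 0\<^sub>v (dim_row M))"

lemma row_orthogonal_if_dependent:
  fixes M :: "'a :: idom mat"
  assumes M: "M \<in> carrier_mat k n" and u: "u \<in> carrier_vec n"
    and v: "v \<in> carrier_vec k" "transpose_mat M *\<^sub>v v = 0\<^sub>v n"
    and i: "i < k" "v $ i \<noteq> 0"
    and orth: "\<And>l. l < k \<Longrightarrow> l \<noteq> i \<Longrightarrow> row M l \<bullet> u = 0"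
  shows "row M i \<bullet> u = 0"
proof -
  have "v $ i * (row M i \<bullet> u) = (\<Sum>l\<in>{i}. v $ l * (row M l \<bullet> u))" by simp
  also have "\<dots> = (\<Sum>l\<in>{0..<k}. v $ l * (row M l \<bullet> u))"
    by (rule sum.mono_neutral_left) (use i orth in auto)
  also have "\<dots> = v \<bullet> (M *\<^sub>v u)" using M by (simp add: scalar_prod_def[of v])
  also have "\<dots> = (transpose_mat M *\<^sub>v v) \<bullet> u"
    by (rule transpose_vec_mult_scalar[OF M u v(1), symmetric])
  also have "\<dots> = 0" using v(2) u by simp
  finally show ?thesis using i(2) by simp
qed

lemma equality_set_remove_dependent_row:
  fixes A :: "'a :: idom mat"
  assumes A: "A \<in> carrier_mat m n" and b: "b \<in> carrier_vec m" and J: "J \<subseteq> {..<m}"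
    and consistent: "equality_set A b J \<noteq> {}"
    and v: "v \<in> carrier_vec (card J)" "transpose_mat (row_submatrix A J) *\<^sub>v v = 0\<^sub>v n"
    and i: "i < card J" "v $ i \<noteq> 0"
  shows "equality_set A b (J - {pick J i}) = equality_set A b J"
proof -
  let ?k = "pick J i"
  have finJ: "finite J" and J': "J - {?k} \<subseteq> {..<m}" using J finite_subset by blast+
  from consistent obtain x where x: "x \<in> carrier_vec n" and xJ: "\<forall>j\<in>J. row A j \<bullet> x = b $ j"
    unfolding ex_in_conv[symmetric] mem_equality_set_iff[OF A b J] by blast
  have row_k: "row A ?k \<bullet> y = b $ ?k"
    if y: "y \<in> carrier_vec n" and yJ: "\<forall>j\<in>J - {?k}. row A j \<bullet> y = b $ j" for y
  proof -
    have row_diff: "row A j \<bullet> (y - x) = row A j \<bullet> y - row A j \<bullet> x" for j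
      using A x y by (intro scalar_prod_minus_distrib) auto
    have "row (row_submatrix A J) l \<bullet> (y - x) = 0" if l: "l < card J" "l \<noteq> i" for l
    proof -
      have "pick J l \<in> J" using l(1) by (rule pick_in_set_le)
      moreover have "pick J l \<noteq> ?k"
        using inj_onD[OF inj_on_pick[OF finJ], of l i] l i(1) by blast
      ultimately show ?thesis using xJ yJ by (simp add: row_row_submatrix[OF A J l(1)] row_diff)
    qed
    then have "row (row_submatrix A J) i \<bullet> (y - x) = 0"
      using x y by (intro row_orthogonal_if_dependent[OF row_submatrix_carrier[OF A J] _ v i]) auto
    then show ?thesis
      using xJ pick_in_set_le[OF i(1)] by (simp add: row_row_submatrix[OF A J i(1)] row_diff)
  qed
  show ?thesis
    unfolding set_eq_iff mem_equality_set_iff[OF A b J] mem_equality_set_iff[OF A b J']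
    using row_k by blast
qed

lemma ex_independent_equality_set_subset_polyhedron:
  fixes A :: "'a :: linordered_field mat"
  assumes A: "A \<in> carrier_mat m n" and b: "b \<in> carrier_vec m" and ne: "polyhedron A b \<noteq> {}"
  shows "\<exists>J\<subseteq>{..<m}. independent_rows (row_submatrix A J) \<and> equality_set A b J \<subseteq> polyhedron A b"
proof -
  define S where
    "S = {J. J \<subseteq> {..<m} \<and> equality_set A b J \<noteq> {} \<and> equality_set A b J \<subseteq> polyhedron A b}"
  have "finite S" by (rule finite_subset[of _ "Pow {..<m}"]) (auto simp: S_def)
  moreover have "S \<noteq> {}" using ex_equality_set_subset_polyhedron[OF A b ne] by (auto simp: S_def)
  ultimately obtain J where J: "J \<in> S" and minimal: "\<And>K. K \<in> S \<Longrightarrow> K \<subseteq> J \<Longrightarrow> K = J"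
    using finite_has_minimal[of S] by metis
  have Jm: "J \<subseteq> {..<m}" and consistent: "equality_set A b J \<noteq> {}" using J by (auto simp: S_def)
  have "v = 0\<^sub>v (card J)"
    if v: "v \<in> carrier_vec (card J)" "transpose_mat (row_submatrix A J) *\<^sub>v v = 0\<^sub>v n" for v
  proof (rule ccontr)
    assume "v \<noteq> 0\<^sub>v (card J)"
    then obtain i where i: "i < card J" "v $ i \<noteq> 0" using v(1) by (auto simp: vec_eq_iff)
    from equality_set_remove_dependent_row[OF A b Jm consistent v i] J
    have "J - {pick J i} \<in> S" by (auto simp: S_def)
    from minimal[OF this] pick_in_set_le[OF i(1)] show False by blast
  qed
  then have "independent_rows (row_submatrix A J)"
    using row_submatrix_carrier[OF A Jm] by (auto simp: independent_rows_def)
  with J show ?thesis by (auto simp: S_def)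
qed

lemma ex_nonzero_kernel_vec:
  fixes B :: "'a :: idom mat"
  assumes B: "B \<in> carrier_mat r c" and rc: "r < c"
  shows "\<exists>v\<in>carrier_vec c. v \<noteq> 0\<^sub>v c \<and> B *\<^sub>v v = 0\<^sub>v r"
proof -
  define padded where
    "padded = mat\<^sub>r c c (\<lambda>i. if i = r then 0\<^sub>v c else if i < r then row B i else 0\<^sub>v c)"
  have padded: "padded \<in> carrier_mat c c" by (simp add: padded_def)
  have "det padded = 0"
    unfolding padded_def using B by (intro det_row_0[OF rc]) (auto simp: Pi_iff)
  then obtain v where v: "v \<in> carrier_vec c" "v \<noteq> 0\<^sub>v c" and kernel: "padded *\<^sub>v v = 0\<^sub>v c"
    using det_0_iff_vec_prod_zero[OF padded] by blast
  have "B *\<^sub>v v = 0\<^sub>v r"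
  proof (rule eq_vecI)
    fix i assume "i < dim_vec (0\<^sub>v r :: 'a vec)"
    then have i: "i < r" by simp
    then have "row padded i = row B i" using B rc by (intro eq_vecI) (auto simp: padded_def)
    then have "(B *\<^sub>v v) $ i = (padded *\<^sub>v v) $ i" using i rc B padded by simp
    then show "(B *\<^sub>v v) $ i = 0\<^sub>v r $ i" using i rc by (simp add: kernel)
  qed (use B in simp)
  with v show ?thesis by blast
qed

lemma independent_rows_dim_le:
  fixes M :: "'a :: idom mat"
  assumes M: "M \<in> carrier_mat k n" and indep: "independent_rows M"
  shows "k \<le> n"
proof (rule ccontr)
  assume "\<not> k \<le> n"
  moreover have "transpose_mat M \<in> carrier_mat n k" using M by simp
  ultimately show False
    using ex_nonzero_kernel_vec[of "transpose_mat M" n k] M indep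
    by (auto simp: independent_rows_def)
qed

section \<open>Pseudoinverses of matrices with invertible Gram matrix\<close>

definition gram_det :: "'a :: comm_ring_1 mat \<Rightarrow> 'a" where
  "gram_det M = det (M * transpose_mat M)"

definition gram_numerator :: "'a :: comm_ring_1 mat \<Rightarrow> 'a vec \<Rightarrow> 'a vec" where
  "gram_numerator M c = transpose_mat M *\<^sub>v (adj_mat (M * transpose_mat M) *\<^sub>v c)"

lemma gram_numerator_carrier: "M \<in> carrier_mat k n \<Longrightarrow> gram_numerator M c \<in> carrier_vec n"
  unfolding gram_numerator_def by (rule carrier_vecI) simp

lemma scalar_prod_self_eq_0:
  fixes w :: "'a :: linordered_idom vec"
  assumes w: "w \<in> carrier_vec n" and "w \<bullet> w = 0"
  shows "w = 0\<^sub>v n"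
proof (rule eq_vecI)
  have "(\<Sum>i<n. w $ i * w $ i) = 0" using assms by (simp add: scalar_prod_def atLeast0LessThan)
  then show "w $ i = 0\<^sub>v n $ i" if "i < dim_vec (0\<^sub>v n :: 'a vec)" for i
    using that by (simp add: sum_nonneg_eq_0_iff)
qed (use w in simp)

lemma independent_rows_gram_det:
  fixes M :: "'a :: linordered_idom mat"
  assumes indep: "independent_rows M"
  shows "gram_det M \<noteq> 0"
proof
  obtain k n where M: "M \<in> carrier_mat k n" by blast
  then have T: "transpose_mat M \<in> carrier_mat n k" by simp
  assume "gram_det M = 0"
  then obtain v where v: "v \<in> carrier_vec k" "v \<noteq> 0\<^sub>v k" and Gv: "M * transpose_mat M *\<^sub>v v = 0\<^sub>v k"
    using det_0_iff_vec_prod_zero[of "M * transpose_mat M" k] M by (auto simp: gram_det_def)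
  let ?w = "transpose_mat M *\<^sub>v v"
  have w: "?w \<in> carrier_vec n" using T v by simp
  have "?w \<bullet> ?w = v \<bullet> (M *\<^sub>v ?w)" using transpose_vec_mult_scalar[OF M w v(1)] .
  also have "M *\<^sub>v ?w = 0\<^sub>v k" using Gv assoc_mult_mat_vec[OF M T v(1)] by simp
  also have "v \<bullet> 0\<^sub>v k = 0" using v by simp
  finally have "?w = 0\<^sub>v n" by (rule scalar_prod_self_eq_0[OF w])
  with indep M v show False by (auto simp: independent_rows_def)
qed

lemma is_pseudoinverse_if_gram_inverse:
  assumes M: "M \<in> carrier_mat k n" and H: "H \<in> carrier_mat k k"
    and inv: "M * transpose_mat M * H = 1\<^sub>m k"
  shows "is_pseudoinverse M (transpose_mat M * H)"
proof -
  let ?T = "transpose_mat M" and ?G = "M * transpose_mat M"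
  have T: "?T \<in> carrier_mat n k" and G: "?G \<in> carrier_mat k k" using M by auto
  have Ht: "transpose_mat H \<in> carrier_mat k k" using H by simp
  have Gt: "transpose_mat ?G = ?G" using transpose_mult[OF M T] by simp
  have inv': "transpose_mat H * ?G = 1\<^sub>m k"
    using transpose_mult[OF G H] unfolding inv Gt by simp
  have "transpose_mat H = transpose_mat H * (?G * H)" using Ht inv by simp
  also have "\<dots> = H" using assoc_mult_mat[OF Ht G H] inv' H by simp
  finally have Hsym: "transpose_mat H = H" .
  have X: "?T * H \<in> carrier_mat n k" using T H by simp
  have MX: "M * (?T * H) = 1\<^sub>m k" using assoc_mult_mat[OF M T H] inv by simp
  have XMX: "?T * H * M * (?T * H) = ?T * H"
    using assoc_mult_mat[OF X M X] unfolding MX right_mult_one_mat[OF X] .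
  have "transpose_mat (?T * H * M) = ?T * transpose_mat (?T * H)"
    by (rule transpose_mult[OF X M])
  also have "\<dots> = ?T * (H * M)" using transpose_mult[OF T H] Hsym by simp
  also have "\<dots> = ?T * H * M" using assoc_mult_mat[OF T H M] by simp
  finally show ?thesis
    unfolding is_pseudoinverse_def using X M MX XMX by auto
qed

lemma
  fixes M :: "real mat"
  assumes M: "M \<in> carrier_mat k n" and c: "c \<in> carrier_vec k" and d: "gram_det M \<noteq> 0"
  shows pseudoinverse_mult_vec: "pseudoinverse M *\<^sub>v c = (1 / gram_det M) \<cdot>\<^sub>v gram_numerator M c"
    and mult_pseudoinverse_mult_vec: "M *\<^sub>v (pseudoinverse M *\<^sub>v c) = c"
proof -
  let ?T = "transpose_mat M" and ?d = "gram_det M"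
  let ?G = "M * ?T"
  have T: "?T \<in> carrier_mat n k" and G: "?G \<in> carrier_mat k k" using M by auto
  note Q = adj_mat(1)[OF G]
  define H where "H = (1 / ?d) \<cdot>\<^sub>m adj_mat ?G"
  have H: "H \<in> carrier_mat k k" using Q by (simp add: H_def)
  have "?G * H = (1 / ?d) \<cdot>\<^sub>m (?d \<cdot>\<^sub>m 1\<^sub>m k)"
    unfolding H_def mult_smult_distrib[OF G Q] adj_mat(2)[OF G] gram_det_def ..
  also have "\<dots> = 1\<^sub>m k" using d by (intro eq_matI) auto
  finally have inv: "?G * H = 1\<^sub>m k" .
  have X: "pseudoinverse M = ?T * H"
    by (rule pseudoinverse_eqI[OF is_pseudoinverse_if_gram_inverse[OF M H inv]])
  have "H *\<^sub>v c = (1 / ?d) \<cdot>\<^sub>v (adj_mat ?G *\<^sub>v c)"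
    unfolding H_def using Q c by (intro eq_vecI) auto
  then show "pseudoinverse M *\<^sub>v c = (1 / ?d) \<cdot>\<^sub>v gram_numerator M c"
    unfolding X gram_numerator_def assoc_mult_mat_vec[OF T H c]
    using mult_mat_vec[OF T mult_mat_vec_carrier[OF Q c]] by simp
  have "M *\<^sub>v (?T * H *\<^sub>v c) = ?G * H *\<^sub>v c"
    using assoc_mult_mat_vec[OF M mult_carrier_mat[OF T H] c] assoc_mult_mat[OF M T H] by simp
  then show "M *\<^sub>v (pseudoinverse M *\<^sub>v c) = c" using c by (simp add: X inv)
qed

lemma ex_pseudoinverse_mem_polyhedron:
  fixes A :: "real mat"
  assumes A: "A \<in> carrier_mat m n" and b: "b \<in> carrier_vec m" and ne: "polyhedron A b \<noteq> {}"
  shows "\<exists>J\<subseteq>{..<m}. card J \<le> n \<and> gram_det (row_submatrix A J) \<noteq> 0 \<and>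
    pseudoinverse (row_submatrix A J) *\<^sub>v subvec b J \<in> polyhedron A b"
proof -
  obtain J where J: "J \<subseteq> {..<m}" and indep: "independent_rows (row_submatrix A J)"
    and sub: "equality_set A b J \<subseteq> polyhedron A b"
    using ex_independent_equality_set_subset_polyhedron[OF assms] by blast
  let ?M = "row_submatrix A J" and ?c = "subvec b J"
  note M = row_submatrix_carrier[OF A J] and c = subvec_carrier[OF b J]
  have d: "gram_det ?M \<noteq> 0" using indep by (rule independent_rows_gram_det)
  have "pseudoinverse ?M *\<^sub>v ?c \<in> carrier_vec n"
    unfolding pseudoinverse_mult_vec[OF M c d] using gram_numerator_carrier[OF M] by simp
  then have "pseudoinverse ?M *\<^sub>v ?c \<in> equality_set A b J"
    using A by (simp add: equality_set_def mult_pseudoinverse_mult_vec[OF M c d])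
  then show ?thesis using sub J d independent_rows_dim_le[OF M indep] by blast
qed

section \<open>Compatibility with ring homomorphisms\<close>

context comm_ring_hom
begin

lemma hom_adj_mat:
  assumes B: "B \<in> carrier_mat k k"
  shows "adj_mat (mat\<^sub>h B) = mat\<^sub>h (adj_mat B)"
proof (rule eq_matI)
  fix i j assume "i < dim_row (mat\<^sub>h (adj_mat B))" "j < dim_col (mat\<^sub>h (adj_mat B))"
  then have ij: "i < k" "j < k" using B by (auto simp: adj_mat_def)
  have "mat_delete (mat\<^sub>h B) j i = mat\<^sub>h (mat_delete B j i)"
    using B ij by (intro eq_matI) (auto simp: mat_delete_def)
  then show "adj_mat (mat\<^sub>h B) $$ (i, j) = mat\<^sub>h (adj_mat B) $$ (i, j)"
    using B ij by (simp add: adj_mat_def cofactor_def hom_distribs)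
qed (auto simp: adj_mat_def)

lemma hom_gram_mat: "mat\<^sub>h M * transpose_mat (mat\<^sub>h M) = mat\<^sub>h (M * transpose_mat M)"
proof -
  obtain k n where M: "M \<in> carrier_mat k n" by blast
  then have "transpose_mat M \<in> carrier_mat n k" by simp
  from mat_hom_mult[OF M this] show ?thesis by (simp add: map_mat_transpose)
qed

lemma hom_gram_det: "gram_det (mat\<^sub>h M) = hom (gram_det M)"
  unfolding gram_det_def hom_gram_mat by (rule hom_det)

lemma hom_gram_numerator:
  assumes M: "M \<in> carrier_mat k n" and c: "c \<in> carrier_vec k"
  shows "gram_numerator (mat\<^sub>h M) (vec\<^sub>h c) = vec\<^sub>h (gram_numerator M c)"
proof -
  have T: "transpose_mat M \<in> carrier_mat n k" and G: "M * transpose_mat M \<in> carrier_mat k k"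
    using M by auto
  note Q = adj_mat(1)[OF G]
  show ?thesis
    unfolding gram_numerator_def hom_gram_mat hom_adj_mat[OF G]
    by (simp add: mult_mat_vec_hom[OF T mult_mat_vec_carrier[OF Q c]] mult_mat_vec_hom[OF Q c]
        map_mat_transpose)
qed

end

lemma eval_mat_carrier: "A \<in> carrier_mat m n \<Longrightarrow> eval_mat A \<delta> \<in> carrier_mat m n"
  by (simp add: eval_mat_def)

lemma eval_vec_carrier: "b \<in> carrier_vec m \<Longrightarrow> eval_vec b \<delta> \<in> carrier_vec m"
  by (simp add: eval_vec_def)

lemma row_eval_mat_scalar_prod:
  assumes A: "A \<in> carrier_mat m n" and v: "v \<in> carrier_vec n" and i: "i < m"
  shows "row (eval_mat A \<delta>) i \<bullet> eval_vec v \<delta> = poly (row A i \<bullet> v) \<delta>"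
proof -
  have "eval_vec (A *\<^sub>v v) \<delta> = eval_mat A \<delta> *\<^sub>v eval_vec v \<delta>"
    unfolding eval_mat_def eval_vec_def
    by (rule semiring_hom.mult_mat_vec_hom[OF poly_hom.semiring_hom_axioms A v])
  from arg_cong[OF this, of "\<lambda>w. w $ i"] show ?thesis
    using A i by (simp add: eval_vec_def eval_mat_def)
qed

section \<open>Degree bounds\<close>

lemma degree_scalar_prod_le:
  fixes v w :: "'a :: comm_semiring_0 poly vec"
  assumes "v \<in> carrier_vec n" "w \<in> carrier_vec n"
    and "\<And>i. i < n \<Longrightarrow> degree (v $ i) \<le> p" "\<And>i. i < n \<Longrightarrow> degree (w $ i) \<le> q"
  shows "degree (v \<bullet> w) \<le> p + q"
  using assms unfolding scalar_prod_def
  by (intro degree_sum_le) (auto intro!: order_trans[OF degree_mult_le] add_mono)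

lemma degree_adj_mat_le:
  fixes B :: "'a :: comm_ring_1 poly mat"
  assumes B: "B \<in> carrier_mat k k" and deg: "\<And>i j. i < k \<Longrightarrow> j < k \<Longrightarrow> degree (B $$ (i, j)) \<le> D"
    and ij: "i < k" "j < k"
  shows "degree (adj_mat B $$ (i, j)) \<le> D * (k - 1)"
proof -
  have "degree (det (mat_delete B j i)) \<le> D * (k - 1)"
    using B ij deg mat_delete_carrier[OF B] by (intro degree_det_le) (auto simp: mat_delete_def)
  moreover have "degree ((- 1 :: 'a poly) ^ (j + i)) = 0"
    using degree_power_le[of "- 1 :: 'a poly" "j + i"] by simp
  ultimately have "degree (cofactor B j i) \<le> D * (k - 1)"
    unfolding cofactor_def by (intro order_trans[OF degree_mult_le]) simp
  then show ?thesis using B ij by (simp add: adj_mat_def)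
qed

lemma degree_gram_mat_le:
  fixes M :: "'a :: comm_semiring_0 poly mat"
  assumes "M \<in> carrier_mat k n" "\<And>i j. i < k \<Longrightarrow> j < n \<Longrightarrow> degree (M $$ (i, j)) \<le> D" "i < k" "j < k"
  shows "degree ((M * transpose_mat M) $$ (i, j)) \<le> 2 * D"
  using assms degree_scalar_prod_le[of "row M i" n "row M j" D D] by (simp add: mult_2)

lemma degree_gram_det_le:
  fixes M :: "'a :: comm_ring_1 poly mat"
  assumes M: "M \<in> carrier_mat k n"
    and deg: "\<And>i j. i < k \<Longrightarrow> j < n \<Longrightarrow> degree (M $$ (i, j)) \<le> D"
  shows "degree (gram_det M) \<le> 2 * k * D"
proof -
  have "degree (gram_det M) \<le> 2 * D * k"
    unfolding gram_det_def using M by (intro degree_det_le degree_gram_mat_le[OF M deg]) auto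
  then show ?thesis by (simp add: ac_simps)
qed

lemma degree_gram_numerator_le:
  fixes M :: "'a :: comm_ring_1 poly mat"
  assumes M: "M \<in> carrier_mat k n" and c: "c \<in> carrier_vec k"
    and degM: "\<And>i j. i < k \<Longrightarrow> j < n \<Longrightarrow> degree (M $$ (i, j)) \<le> D"
    and degc: "\<And>i. i < k \<Longrightarrow> degree (c $ i) \<le> D"
    and j: "j < n"
  shows "degree (gram_numerator M c $ j) \<le> 2 * k * D"
proof (cases "k = 0")
  case True
  with M c j show ?thesis by (simp add: gram_numerator_def scalar_prod_def)
next
  case False
  let ?G = "M * transpose_mat M"
  have G: "?G \<in> carrier_mat k k" using M by simp
  note Q = adj_mat(1)[OF G]
  define u where "u = adj_mat ?G *\<^sub>v c"
  have u: "u \<in> carrier_vec k" using Q c by (simp add: u_def)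
  have "degree (adj_mat ?G $$ (i, l)) \<le> 2 * D * (k - 1)" if "i < k" "l < k" for i l
    by (rule degree_adj_mat_le[OF G degree_gram_mat_le[OF M degM] that])
  then have "degree (u $ i) \<le> 2 * D * (k - 1) + D" if "i < k" for i
    using that Q c degc degree_scalar_prod_le[of "row (adj_mat ?G) i" k c "2 * D * (k - 1)" D]
    by (simp add: u_def)
  then have "degree (col M j \<bullet> u) \<le> D + (2 * D * (k - 1) + D)"
    using M u j degM by (intro degree_scalar_prod_le[of _ k]) auto
  also have "\<dots> = 2 * k * D" using False by (cases k) (simp_all add: algebra_simps)
  finally show ?thesis using M j by (simp add: gram_numerator_def u_def)
qed

section \<open>Rational functions as quotients\<close>

lemma
  fixes p q :: "real poly"
  assumes q: "q \<noteq> 0"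
  shows rat_num_Fract_mult: "rat_num (Fract p q) * q = p * rat_den (Fract p q)"
    and rat_den_Fract_dvd: "rat_den (Fract p q) dvd q"
    and rat_num_Fract_dvd: "rat_num (Fract p q) dvd p"
proof -
  let ?r = "Fract p q"
  have "Fract (rat_num ?r) (rat_den ?r) = ?r" by (simp add: rat_num_def rat_den_def)
  then show cross: "rat_num ?r * q = p * rat_den ?r"
    using q by (subst (asm) eq_fract) (auto simp: rat_den_def)
  have coprime: "coprime (rat_num ?r) (rat_den ?r)"
    unfolding rat_num_def rat_den_def by (rule coprime_quot_of_fract)
  have "rat_den ?r dvd rat_num ?r * q" unfolding cross by simp
  then show "rat_den ?r dvd q" using coprime by (metis coprime_commute coprime_dvd_mult_right_iff)
  have "rat_num ?r dvd p * rat_den ?r" unfolding cross[symmetric] by simp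
  then show "rat_num ?r dvd p" using coprime by (metis coprime_dvd_mult_left_iff)
qed

lemma
  assumes "poly q \<delta> \<noteq> 0"
  shows poly_rat_den_Fract_neq_0: "poly (rat_den (Fract p q)) \<delta> \<noteq> 0"
    and rat_eval_Fract: "rat_eval (Fract p q) \<delta> = poly p \<delta> / poly q \<delta>"
proof -
  have q: "q \<noteq> 0" using assms by auto
  obtain s where "q = rat_den (Fract p q) * s" using rat_den_Fract_dvd[OF q] by (rule dvdE)
  then have "poly q \<delta> = poly (rat_den (Fract p q)) \<delta> * poly s \<delta>" by (metis poly_mult)
  with assms show den: "poly (rat_den (Fract p q)) \<delta> \<noteq> 0" by auto
  have "poly (rat_num (Fract p q)) \<delta> * poly q \<delta> = poly p \<delta> * poly (rat_den (Fract p q)) \<delta>"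
    using arg_cong[OF rat_num_Fract_mult[OF q], of "\<lambda>r. poly r \<delta>"] by simp
  with den assms show "rat_eval (Fract p q) \<delta> = poly p \<delta> / poly q \<delta>"
    by (simp add: rat_eval_def frac_eq_eq)
qed

lemma degree_rat_num_Fract_le:
  assumes "q \<noteq> 0"
  shows "degree (rat_num (Fract p q)) \<le> degree p"
proof (cases "p = 0")
  case True
  with rat_num_Fract_mult[OF assms, of p] assms show ?thesis by simp
next
  case False
  with rat_num_Fract_dvd[OF assms, of p] show ?thesis by (rule dvd_imp_degree_le)
qed

lemma degree_Lcm_rat_den_Fract_le:
  assumes "q \<noteq> 0"
  shows "degree (Lcm ((\<lambda>i. rat_den (Fract (p i) q)) ` I)) \<le> degree q"
proof (rule dvd_imp_degree_le[OF Lcm_least assms])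
  show "r dvd q" if "r \<in> (\<lambda>i. rat_den (Fract (p i) q)) ` I" for r
    using that rat_den_Fract_dvd[OF assms] by blast
qed

section \<open>Signs of polynomials to the right of a point\<close>

lemma eventually_sgn_poly_at_right:
  fixes p :: "real poly"
  shows "\<exists>s. \<forall>\<^sub>F x in at_right a. sgn (poly p x) = s"
proof (cases "p = 0")
  case False
  then obtain q where pq: "p = [:- a, 1:] ^ order a p * q" and "\<not> [:- a, 1:] dvd q"
    using order_decomp by blast
  then have "poly q a \<noteq> 0" by (simp add: poly_eq_0_iff_dvd)
  then have "((\<lambda>x. sgn (poly q x)) \<longlongrightarrow> sgn (poly q a)) (at_right a)"
    by (intro tendsto_intros)
  then have "\<forall>\<^sub>F x in at_right a. dist (sgn (poly q x)) (sgn (poly q a)) < 1"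
    by (rule tendstoD) simp
  then have "\<forall>\<^sub>F x in at_right a. sgn (poly q x) = sgn (poly q a)"
    by eventually_elim (auto simp: sgn_if dist_real_def split: if_splits)
  then have "\<forall>\<^sub>F x in at_right a. sgn (poly p x) = sgn (poly q a)"
    using eventually_at_right_less[of a]
    by eventually_elim (subst pq, simp add: sgn_mult)
  then show ?thesis by blast
qed simp

lemma frequently_sgn_poly_imp_eventually:
  fixes p :: "real poly"
  assumes "\<exists>\<^sub>F x in at_right a. P (sgn (poly p x))"
  shows "\<forall>\<^sub>F x in at_right a. P (sgn (poly p x))"
proof -
  obtain s where s: "\<forall>\<^sub>F x in at_right a. sgn (poly p x) = s"
    using eventually_sgn_poly_at_right by blast
  from frequently_eventually_frequently[OF assms s] have "P s"
    by (auto dest: frequently_ex)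
  with s show ?thesis by (auto elim: eventually_mono)
qed

section \<open>Pseudoinverse solutions of polynomial systems\<close>

definition pseudoinverse_solution :: "'a :: idom mat \<Rightarrow> 'a vec \<Rightarrow> nat set \<Rightarrow> 'a fract vec" where
  "pseudoinverse_solution A b J = vec (dim_col A)
     (\<lambda>j. Fract (gram_numerator (row_submatrix A J) (subvec b J) $ j)
       (gram_det (row_submatrix A J)))"

lemma pseudoinverse_solution_carrier:
  "A \<in> carrier_mat m n \<Longrightarrow> pseudoinverse_solution A b J \<in> carrier_vec n"
  by (simp add: pseudoinverse_solution_def)

lemma
  assumes A: "A \<in> carrier_mat m n" and b: "b \<in> carrier_vec m" and J: "J \<subseteq> {..<m}"
    and d: "poly (gram_det (row_submatrix A J)) \<delta> \<noteq> 0"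
  shows rat_eval_pseudoinverse_solution_gram: "rat_eval_vec (pseudoinverse_solution A b J) \<delta> =
      (1 / poly (gram_det (row_submatrix A J)) \<delta>) \<cdot>\<^sub>v
        eval_vec (gram_numerator (row_submatrix A J) (subvec b J)) \<delta>"
    and rat_eval_pseudoinverse_solution: "rat_eval_vec (pseudoinverse_solution A b J) \<delta> =
      pseudoinverse (row_submatrix (eval_mat A \<delta>) J) *\<^sub>v subvec (eval_vec b \<delta>) J"
proof -
  let ?M = "row_submatrix A J" and ?c = "subvec b J"
  note M = row_submatrix_carrier[OF A J] and c = subvec_carrier[OF b J]
  show solution: "rat_eval_vec (pseudoinverse_solution A b J) \<delta> =
      (1 / poly (gram_det ?M) \<delta>) \<cdot>\<^sub>v eval_vec (gram_numerator ?M ?c) \<delta>"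
    using A gram_numerator_carrier[OF M, of ?c] rat_eval_Fract[OF d]
    by (intro eq_vecI) (auto simp: rat_eval_vec_def eval_vec_def pseudoinverse_solution_def)
  note evM = eval_mat_carrier[OF M] and evc = eval_vec_carrier[OF c]
  have "gram_det (eval_mat ?M \<delta>) = poly (gram_det ?M) \<delta>"
    unfolding eval_mat_def by (rule poly_hom.hom_gram_det)
  moreover have "gram_numerator (eval_mat ?M \<delta>) (eval_vec ?c \<delta>) = eval_vec (gram_numerator ?M ?c) \<delta>"
    unfolding eval_mat_def eval_vec_def by (rule poly_hom.hom_gram_numerator[OF M c])
  ultimately have "pseudoinverse (eval_mat ?M \<delta>) *\<^sub>v eval_vec ?c \<delta> =
      (1 / poly (gram_det ?M) \<delta>) \<cdot>\<^sub>v eval_vec (gram_numerator ?M ?c) \<delta>"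
    using pseudoinverse_mult_vec[OF evM evc, of \<delta> \<delta>] d by simp
  then show "rat_eval_vec (pseudoinverse_solution A b J) \<delta> =
      pseudoinverse (row_submatrix (eval_mat A \<delta>) J) *\<^sub>v subvec (eval_vec b \<delta>) J"
    unfolding solution
    by (simp add: eval_mat_def eval_vec_def row_submatrix_map_mat[OF A J] subvec_map_vec[OF b J])
qed

lemma poly_rat_den_pseudoinverse_solution_neq_0:
  assumes "A \<in> carrier_mat m n" "poly (gram_det (row_submatrix A J)) \<delta> \<noteq> 0" "j < n"
  shows "poly (rat_den (pseudoinverse_solution A b J $ j)) \<delta> \<noteq> 0"
  using assms poly_rat_den_Fract_neq_0 by (simp add: pseudoinverse_solution_def)

lemma
  assumes A: "A \<in> carrier_mat m n" and b: "b \<in> carrier_vec m" and J: "J \<subseteq> {..<m}"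
    and degA: "\<forall>i<m. \<forall>j<n. degree (A $$ (i, j)) \<le> D" and degb: "\<forall>i<m. degree (b $ i) \<le> D"
    and k: "card J \<le> k" and d: "gram_det (row_submatrix A J) \<noteq> 0"
  shows degree_rat_num_pseudoinverse_solution_le:
      "\<And>j. j < n \<Longrightarrow> degree (rat_num (pseudoinverse_solution A b J $ j)) \<le> 2 * k * D"
    and degree_Lcm_rat_den_pseudoinverse_solution_le:
      "degree (Lcm ((\<lambda>j. rat_den (pseudoinverse_solution A b J $ j)) ` {..<n})) \<le> 2 * k * D"
proof -
  let ?M = "row_submatrix A J" and ?c = "subvec b J"
  let ?p = "\<lambda>j. gram_numerator ?M ?c $ j"
  have degM: "degree (?M $$ (i, j)) \<le> D" if "i < card J" "j < n" for i j
    using that degA pick_less[OF J] by (simp add: row_submatrix_index[OF A J])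
  have degc: "degree (?c $ i) \<le> D" if "i < card J" for i
    using that degb pick_less[OF J] by (simp add: subvec_index[OF b J])
  note M = row_submatrix_carrier[OF A J] and c = subvec_carrier[OF b J]
  have bound: "2 * card J * D \<le> 2 * k * D" using k by simp
  have solution: "pseudoinverse_solution A b J $ j = Fract (?p j) (gram_det ?M)" if "j < n" for j
    using A that by (simp add: pseudoinverse_solution_def)
  show "degree (rat_num (pseudoinverse_solution A b J $ j)) \<le> 2 * k * D" if "j < n" for j
    unfolding solution[OF that]
    using degree_rat_num_Fract_le[OF d] degree_gram_numerator_le[OF M c degM degc that] bound
    by (meson order_trans)
  have "(\<lambda>j. rat_den (pseudoinverse_solution A b J $ j)) ` {..<n} =
      (\<lambda>j. rat_den (Fract (?p j) (gram_det ?M))) ` {..<n}"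
    by (intro image_cong) (simp_all add: solution)
  then show "degree (Lcm ((\<lambda>j. rat_den (pseudoinverse_solution A b J $ j)) ` {..<n})) \<le> 2 * k * D"
    using order_trans[OF order_trans[OF degree_Lcm_rat_den_Fract_le[OF d, of ?p]
        degree_gram_det_le[OF M degM]] bound]
    by (simp only:)
qed

lemma le_divide_iff_mult_nonneg:
  fixes a b c :: "'a :: linordered_field"
  assumes "c \<noteq> 0"
  shows "a \<le> b / c \<longleftrightarrow> 0 \<le> (b - a * c) * c"
  using assms by (cases "c > 0") (auto simp: zero_le_mult_iff field_simps)

definition solved_by_pseudoinverse ::
    "real poly mat \<Rightarrow> real poly vec \<Rightarrow> nat set \<Rightarrow> real \<Rightarrow> bool" where
  "solved_by_pseudoinverse A b J \<delta> \<longleftrightarrow> poly (gram_det (row_submatrix A J)) \<delta> \<noteq> 0 \<and>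
     rat_eval_vec (pseudoinverse_solution A b J) \<delta> \<in> polyhedron (eval_mat A \<delta>) (eval_vec b \<delta>)"

lemma solved_by_pseudoinverseD:
  assumes A: "A \<in> carrier_mat m n" and b: "b \<in> carrier_vec m" and J: "J \<subseteq> {..<m}"
    and solved: "solved_by_pseudoinverse A b J \<delta>"
  defines "x \<equiv> pseudoinverse_solution A b J"
  shows "\<forall>j<n. poly (rat_den (x $ j)) \<delta> \<noteq> 0"
    and "eval_vec b \<delta> \<le> eval_mat A \<delta> *\<^sub>v rat_eval_vec x \<delta>"
    and "rat_eval_vec x \<delta> =
      pseudoinverse (row_submatrix (eval_mat A \<delta>) J) *\<^sub>v subvec (eval_vec b \<delta>) J"
proof -
  have d: "poly (gram_det (row_submatrix A J)) \<delta> \<noteq> 0"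
    using solved by (simp add: solved_by_pseudoinverse_def)
  show "\<forall>j<n. poly (rat_den (x $ j)) \<delta> \<noteq> 0"
    unfolding x_def using poly_rat_den_pseudoinverse_solution_neq_0[OF A d] by blast
  show "eval_vec b \<delta> \<le> eval_mat A \<delta> *\<^sub>v rat_eval_vec x \<delta>"
    using solved by (simp add: solved_by_pseudoinverse_def polyhedron_def x_def)
  show "rat_eval_vec x \<delta> =
      pseudoinverse (row_submatrix (eval_mat A \<delta>) J) *\<^sub>v subvec (eval_vec b \<delta>) J"
    unfolding x_def by (rule rat_eval_pseudoinverse_solution[OF A b J d])
qed

text \<open>Multiplying a slack by the square of the Gram determinant turns it into a polynomial without
  changing its sign.\<close>

lemma solved_by_pseudoinverse_iff_sgn:
  assumes A: "A \<in> carrier_mat m n" and b: "b \<in> carrier_vec m" and J: "J \<subseteq> {..<m}"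
  defines "d \<equiv> gram_det (row_submatrix A J)"
    and "N \<equiv> gram_numerator (row_submatrix A J) (subvec b J)"
  shows "solved_by_pseudoinverse A b J \<delta> \<longleftrightarrow> sgn (poly d \<delta>) \<noteq> 0 \<and>
    (\<forall>i\<in>{..<m}. 0 \<le> sgn (poly ((row A i \<bullet> N - b $ i * d) * d) \<delta>))"
proof (cases "poly d \<delta> = 0")
  case True
  then show ?thesis by (simp add: solved_by_pseudoinverse_def d_def)
next
  case False
  let ?x = "(1 / poly d \<delta>) \<cdot>\<^sub>v eval_vec N \<delta>"
  note evA = eval_mat_carrier[OF A] and evb = eval_vec_carrier[OF b]
  have N: "N \<in> carrier_vec n"
    unfolding N_def by (rule gram_numerator_carrier[OF row_submatrix_carrier[OF A J]])
  note evN = eval_vec_carrier[OF N]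
  have row_x: "row (eval_mat A \<delta>) i \<bullet> ?x = poly (row A i \<bullet> N) \<delta> / poly d \<delta>" if "i < m" for i
    using evA[of \<delta>] evN[of \<delta>] that by (simp add: row_eval_mat_scalar_prod[OF A N])
  have "rat_eval_vec (pseudoinverse_solution A b J) \<delta> = ?x"
    using rat_eval_pseudoinverse_solution_gram[OF A b J] False by (simp add: d_def N_def)
  then have "solved_by_pseudoinverse A b J \<delta> \<longleftrightarrow> ?x \<in> polyhedron (eval_mat A \<delta>) (eval_vec b \<delta>)"
    using False by (simp add: solved_by_pseudoinverse_def d_def)
  also have "\<dots> \<longleftrightarrow> (\<forall>i<m. poly (b $ i) \<delta> \<le> poly (row A i \<bullet> N) \<delta> / poly d \<delta>)"
    unfolding mem_polyhedron_iff[OF evA evb] using evN[of \<delta>] b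
    by (simp add: row_x) (simp add: eval_vec_def)
  also have "\<dots> \<longleftrightarrow> (\<forall>i\<in>{..<m}. 0 \<le> poly ((row A i \<bullet> N - b $ i * d) * d) \<delta>)"
    by (simp add: le_divide_iff_mult_nonneg[OF False] Ball_def)
  finally show ?thesis using False by (simp add: sgn_zero_iff)
qed

lemma eventually_solved_by_pseudoinverse:
  assumes A: "A \<in> carrier_mat m n" and b: "b \<in> carrier_vec m" and J: "J \<subseteq> {..<m}"
    and freq: "\<exists>\<^sub>F \<delta> in at_right a. solved_by_pseudoinverse A b J \<delta>"
  shows "\<forall>\<^sub>F \<delta> in at_right a. solved_by_pseudoinverse A b J \<delta>"
proof -
  let ?d = "gram_det (row_submatrix A J)"
    and ?N = "gram_numerator (row_submatrix A J) (subvec b J)"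
  note sgn_iff = solved_by_pseudoinverse_iff_sgn[OF A b J]
  have "\<forall>\<^sub>F \<delta> in at_right a. sgn (poly ?d \<delta>) \<noteq> 0"
    using freq unfolding sgn_iff
    by (intro frequently_sgn_poly_imp_eventually) (auto elim: frequently_elim1)
  moreover have
    "\<forall>\<^sub>F \<delta> in at_right a. \<forall>i\<in>{..<m}. 0 \<le> sgn (poly ((row A i \<bullet> ?N - b $ i * ?d) * ?d) \<delta>)"
    using freq unfolding sgn_iff
    by (intro eventually_ball_finite finite_lessThan ballI frequently_sgn_poly_imp_eventually)
      (auto elim: frequently_elim1)
  ultimately show ?thesis unfolding sgn_iff by (rule eventually_conj)
qed

lemma ex_eventually_solved_by_pseudoinverse:
  assumes A: "A \<in> carrier_mat m n" and b: "b \<in> carrier_vec m"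
    and solvable: "\<exists>\<^sub>F \<delta> in at_right a. polyhedron (eval_mat A \<delta>) (eval_vec b \<delta>) \<noteq> {}"
  shows "\<exists>J\<subseteq>{..<m}. card J \<le> n \<and> (\<forall>\<^sub>F \<delta> in at_right a. solved_by_pseudoinverse A b J \<delta>)"
proof -
  define S where "S = {J. J \<subseteq> {..<m} \<and> card J \<le> n}"
  have "\<exists>J\<in>S. solved_by_pseudoinverse A b J \<delta>"
    if nonempty: "polyhedron (eval_mat A \<delta>) (eval_vec b \<delta>) \<noteq> {}" for \<delta>
  proof -
    from ex_pseudoinverse_mem_polyhedron[OF eval_mat_carrier[OF A] eval_vec_carrier[OF b] nonempty]
    obtain J where J: "J \<subseteq> {..<m}" "card J \<le> n"
      and d: "gram_det (row_submatrix (eval_mat A \<delta>) J) \<noteq> 0"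
      and feasible: "pseudoinverse (row_submatrix (eval_mat A \<delta>) J) *\<^sub>v subvec (eval_vec b \<delta>) J
        \<in> polyhedron (eval_mat A \<delta>) (eval_vec b \<delta>)" by blast
    have "poly (gram_det (row_submatrix A J)) \<delta> \<noteq> 0"
      using d by (simp add: eval_mat_def row_submatrix_map_mat[OF A J(1)] poly_hom.hom_gram_det)
    with J feasible show ?thesis
      by (auto simp: S_def solved_by_pseudoinverse_def rat_eval_pseudoinverse_solution[OF A b])
  qed
  then have freq: "\<exists>\<^sub>F \<delta> in at_right a. \<exists>J\<in>S. solved_by_pseudoinverse A b J \<delta>"
    by (rule frequently_elim1[OF solvable])
  have "finite S" by (rule finite_subset[of _ "Pow {..<m}"]) (auto simp: S_def)
  from frequently_bex_finite[OF this freq] obtain J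
    where "J \<in> S" "\<exists>\<^sub>F \<delta> in at_right a. solved_by_pseudoinverse A b J \<delta>" by blast
  then show ?thesis using eventually_solved_by_pseudoinverse[OF A b] by (auto simp: S_def)
qed

theorem theorem12:
  fixes A :: "real poly mat" and b :: "real poly vec" and m n D :: nat
  assumes "A \<in> carrier_mat m n"
    and "b \<in> carrier_vec m"
    and "\<forall>i<m. \<forall>j<n. degree (A $$ (i, j)) \<le> D"
    and "\<forall>i<m. degree (b $ i) \<le> D"
    and "\<exists>\<epsilon>>0. \<forall>\<delta>\<in>{0<..<\<epsilon>}. \<exists>x\<^sub>1\<in>carrier_vec n. eval_mat A \<delta> *\<^sub>v x\<^sub>1 \<ge> eval_vec b \<delta>"
  shows "\<exists>x\<in>carrier_vec n. \<exists>J\<subseteq>{..<m}. \<exists>\<epsilon>'>0.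
           (\<forall>\<delta>\<in>{0<..<\<epsilon>'}.
              (\<forall>j<n. poly (rat_den (x $ j)) \<delta> \<noteq> 0) \<and>
              eval_mat A \<delta> *\<^sub>v rat_eval_vec x \<delta> \<ge> eval_vec b \<delta> \<and>
              rat_eval_vec x \<delta> =
                pseudoinverse (row_submatrix (eval_mat A \<delta>) J) *\<^sub>v subvec (eval_vec b \<delta>) J) \<and>
           (\<forall>j<n. degree (rat_num (x $ j)) \<le> 2 * n * D) \<and>
           degree (Lcm ((\<lambda>j. rat_den (x $ j)) ` {..<n})) \<le> 2 * n * D"
proof -
  note A = assms(1) and b = assms(2)
  have "\<forall>\<^sub>F \<delta> in at_right 0. polyhedron (eval_mat A \<delta>) (eval_vec b \<delta>) \<noteq> {}"
    using assms(5) eval_mat_carrier[OF A]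
    by (fastforce simp: eventually_at_right_field polyhedron_def)
  from ex_eventually_solved_by_pseudoinverse[OF A b eventually_frequently[OF _ this]]
  obtain J where J: "J \<subseteq> {..<m}" "card J \<le> n"
    and "\<forall>\<^sub>F \<delta> in at_right 0. solved_by_pseudoinverse A b J \<delta>" by auto
  then obtain \<epsilon>' where \<epsilon>': "\<epsilon>' > 0"
    and solved: "\<And>\<delta>. \<delta> \<in> {0<..<\<epsilon>'} \<Longrightarrow> solved_by_pseudoinverse A b J \<delta>"
    by (auto simp: eventually_at_right_field)
  have d: "gram_det (row_submatrix A J) \<noteq> 0"
    using solved[of "\<epsilon>' / 2"] \<epsilon>' by (auto simp: solved_by_pseudoinverse_def)
  show ?thesis
    using J(1) \<epsilon>' solved_by_pseudoinverseD[OF A b J(1) solved]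
      degree_rat_num_pseudoinverse_solution_le[OF A b J(1) assms(3,4) J(2) d]
      degree_Lcm_rat_den_pseudoinverse_solution_le[OF A b J(1) assms(3,4) J(2) d]
    by (intro bexI[OF _ pseudoinverse_solution_carrier[OF A]] exI[of _ J] exI[of _ \<epsilon>']
        conjI ballI) blast+
qed

end
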